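(* Let $G$ be a group that is hyperbolic relative to a finite collection of subgroups $\mathbb{P}$, let $H$ be a subgroup of $G$, and let $K_1$ and $K_2$ be two $(G,\mathbb{P})$-graphs. Suppose that there is a non-empty, connected, quasi-isometrically embedded subgraph $L_1$ of $K_1$ that is $H$-invariant and has finitely many $H$-orbits of edges. Then there is a non-empty, connected, quasi-isometrically embedded subgraph $L_2$ of $K_2$ that is $H$-invariant and has finitely many $H$-orbits of edges. In other words, whether $H$ is quasiconvex relative to $\mathbb{P}$ does not depend on the choice of $(G,\mathbb{P})$-graph.
   Context: A graph is a 1-dimensional complex (loops and multiple edges allowed), with the path metric in which edges have length 1; hyperbolic means Gromov hyperbolic for this metric. A circuit is an embedded cycle. A graph is fine if for each $n$, each edge is contained in only finitely many circuits of length $n$. Groups are not assumed countable. $G$ is hyperbolic relative to a finite collection of subgroups $\mathbb{P}$ if $G$ acts without inversions on a connected, fine, hyperbolic graph $K$ with finite edge stabilizers and finitely many orbits of edges, and $\mathbb{P}$ is a set of representatives of distinct conjugacy classes of vertex stabilizers such that each infinite vertex stabilizer is represented (i.e. members of $\mathbb{P}$ are vertex stabilizers, are pairwise non-conjugate, and every infinite vertex stabilizer is conjugate to a member of $\mathbb{P}$). Such a $K$ with such an action is called a $(G,\mathbb{P})$-graph. A connected subgraph $L\subset K$ is quasi-isometrically embedded if the inclusion $L\to K$ is a quasi-isometric embedding with respect to the path metrics of $L$ and $K$. A subgroup $H\le G$ is quasiconvex relative to $\mathbb{P}$ if for some $(G,\mathbb{P})$-graph $K$ there is a non-empty, connected,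 quasi-isometrically embedded subgraph $L$ of $K$ that is $H$-invariant and has finitely many $H$-orbits of edges. *)

theory Defs
  imports
    Complex_Main
    "HOL-Algebra.Group_Action"
    "Graph_Theory.Bidirected_Digraph"
    "Graph_Theory.Digraph_Component"
    "Graph_Theory.Arc_Walk"
begin

text \<open>
  A graph (1-dimensional complex, loops and multiple edges allowed) is encoded as a graph in the
  sense of Serre, i.e. as a \<^locale>\<open>bidirected_digraph\<close>: every geometric edge is a pair
  of distinct, mutually inverse arcs \<open>a\<close> and \<open>arev a\<close>. In particular a loop also consists of two
  arcs, so that an automorphism can invert it.
\<close>


subsection \<open>Gromov hyperbolicity and quasi-isometric embeddings\<close>

definition gromov_product :: "('p \<Rightarrow> 'p \<Rightarrow> real) \<Rightarrow> 'p \<Rightarrow> 'p \<Rightarrow> 'p \<Rightarrow> real" where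
  "gromov_product d w x y = (d x w + d y w - d x y) / 2"

definition gromov_hyperbolic :: "'p set \<Rightarrow> ('p \<Rightarrow> 'p \<Rightarrow> real) \<Rightarrow> bool" where
  "gromov_hyperbolic S d \<longleftrightarrow>
     (\<exists>\<delta>\<ge>0. \<forall>w\<in>S. \<forall>x\<in>S. \<forall>y\<in>S. \<forall>z\<in>S.
        gromov_product d w x z \<ge>
          min (gromov_product d w x y) (gromov_product d w y z) - \<delta>)"

definition quasi_isometric_embedding ::
  "'p set \<Rightarrow> ('p \<Rightarrow> 'p \<Rightarrow> real) \<Rightarrow> 'q set \<Rightarrow> ('q \<Rightarrow> 'q \<Rightarrow> real) \<Rightarrow> ('p \<Rightarrow> 'q) \<Rightarrow> bool"
where
  "quasi_isometric_embedding S d S' d' f \<longleftrightarrow>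
     f ` S \<subseteq> S' \<and>
     (\<exists>k\<ge>1. \<exists>c\<ge>0. \<forall>x\<in>S. \<forall>y\<in>S.
        d x y / k - c \<le> d' (f x) (f y) \<and> d' (f x) (f y) \<le> k * d x y + c)"


subsection \<open>The path metric on the 1-complex\<close>

text \<open>
  \<open>Interior a t\<close> is the point of the open edge \<open>a\<close> at distance \<open>t\<close> from \<open>tail a\<close>. The names
  \<open>Interior a t\<close> and \<open>Interior (arev a) (1 - t)\<close> denote the same point of the complex; they are
  not identified, but are at distance 0 for \<open>path_dist\<close> below, which is thus a pseudometric whose
  metric quotient is the 1-complex with its path metric.
\<close>

datatype ('v, 'e) point = Vertex 'v | Interior 'e real

definition points :: "('v, 'e) pre_digraph \<Rightarrow> ('v, 'e) point set" where
  "points K = Vertex ` verts K \<union> {Interior a t | a t. a \<in> arcs K \<and> 0 < t \<and> t < 1}"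

text \<open>The ways to leave the open cell of a point: a vertex reached, and the length needed.\<close>

fun exits :: "('v, 'e) pre_digraph \<Rightarrow> ('v, 'e) point \<Rightarrow> ('v \<times> real) set" where
  "exits K (Vertex v) = {(v, 0)}"
| "exits K (Interior a t) = {(tail K a, t), (head K a, 1 - t)}"

text \<open>The length of the segment joining two points inside one open edge, if there is one.\<close>

fun inner_lengths :: "('e \<Rightarrow> 'e) \<Rightarrow> ('v, 'e) point \<Rightarrow> ('v, 'e) point \<Rightarrow> real set" where
  "inner_lengths arev (Interior a s) (Interior b t) =
     (if b = a then {\<bar>s - t\<bar>} else if b = arev a then {\<bar>s - (1 - t)\<bar>} else {})"
| "inner_lengths arev _ _ = {}"

text \<open>
  A path either stays inside an open edge, or leaves the cell of \<open>x\<close> at a vertex, follows an edge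
  path, and enters the cell of \<open>y\<close> from a vertex. On vertices \<open>path_dist\<close> is therefore the least
  number of edges of an edge path.
\<close>

definition path_lengths ::
  "('v, 'e) pre_digraph \<Rightarrow> ('e \<Rightarrow> 'e) \<Rightarrow> ('v, 'e) point \<Rightarrow> ('v, 'e) point \<Rightarrow> real set"
where
  "path_lengths K arev x y =
     {r + real (length p) + s | v r p w s.
        (v, r) \<in> exits K x \<and> (w, s) \<in> exits K y \<and> pre_digraph.awalk K v p w}
     \<union> inner_lengths arev x y"

definition path_dist ::
  "('v, 'e) pre_digraph \<Rightarrow> ('e \<Rightarrow> 'e) \<Rightarrow> ('v, 'e) point \<Rightarrow> ('v, 'e) point \<Rightarrow> real"
where
  "path_dist K arev x y = Inf (path_lengths K arev x y)"

definition hyperbolic_graph :: "('v, 'e) pre_digraph \<Rightarrow> ('e \<Rightarrow> 'e) \<Rightarrow> bool" where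
  "hyperbolic_graph K arev \<longleftrightarrow> gromov_hyperbolic (points K) (path_dist K arev)"


subsection \<open>Fine graphs\<close>

text \<open>
  \<^const>\<open>pre_digraph.cycle\<close> demands a non-empty closed walk without repeated vertices. This still
  allows going back and forth along one edge, which is not an embedded circle. A circuit of
  length \<open>n\<close>, as a subgraph, is represented by exactly \<open>2 * n\<close> such arc lists (choice of starting
  vertex and direction), so finiteness may be stated for arc lists; if the circuit contains the
  edge \<open>{a, arev a}\<close>, then one of its two directions traverses \<open>a\<close>.
\<close>

definition circuit :: "('v, 'e) pre_digraph \<Rightarrow> ('e \<Rightarrow> 'e) \<Rightarrow> 'e list \<Rightarrow> bool" where
  "circuit K arev p \<longleftrightarrow> pre_digraph.cycle K p \<and> (\<forall>a\<in>set p. arev a \<notin> set p)"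

definition fine_graph :: "('v, 'e) pre_digraph \<Rightarrow> ('e \<Rightarrow> 'e) \<Rightarrow> bool" where
  "fine_graph K arev \<longleftrightarrow>
     (\<forall>n. \<forall>a\<in>arcs K. finite {p. circuit K arev p \<and> length p = n \<and> a \<in> set p})"


subsection \<open>Group actions on graphs and relative hyperbolicity\<close>

locale graph_action =
  group G + bidirected_digraph K arev +
  vertex_action: group_action G "verts K" \<phi> +
  arc_action: group_action G "arcs K" \<psi>
  for G :: "('g, 'm) monoid_scheme" (structure)
    and K :: "('v, 'e) pre_digraph" and arev :: "'e \<Rightarrow> 'e"
    and \<phi> :: "'g \<Rightarrow> 'v \<Rightarrow> 'v" and \<psi> :: "'g \<Rightarrow> 'e \<Rightarrow> 'e" +
  assumes tail_equivariant:
      "\<lbrakk>g \<in> carrier G; a \<in> arcs K\<rbrakk> \<Longrightarrow> tail K (\<psi> g a) = \<phi> g (tail K a)"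
    and head_equivariant:
      "\<lbrakk>g \<in> carrier G; a \<in> arcs K\<rbrakk> \<Longrightarrow> head K (\<psi> g a) = \<phi> g (head K a)"
    and arev_equivariant:
      "\<lbrakk>g \<in> carrier G; a \<in> arcs K\<rbrakk> \<Longrightarrow> \<psi> g (arev a) = arev (\<psi> g a)"

definition conjugate_in :: "('g, 'm) monoid_scheme \<Rightarrow> 'g set \<Rightarrow> 'g set \<Rightarrow> bool" where
  "conjugate_in G A B \<longleftrightarrow>
     (\<exists>g\<in>carrier G. A = g <#\<^bsub>G\<^esub> (B #>\<^bsub>G\<^esub> inv\<^bsub>G\<^esub> g))"

text \<open>
  A \<open>(G, \<P>)\<close>-graph. Since there are no inversions, the stabilizer of a geometric edge is the
  stabilizer of either of its arcs; and there are finitely many orbits of geometric edges iff there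
  are finitely many orbits of arcs. Connected graphs are non-empty, by definition of
  \<^const>\<open>Digraph_Component.connected\<close>.
\<close>

locale GP_graph =
  graph_action G K arev \<phi> \<psi>
  for G :: "('g, 'm) monoid_scheme" (structure)
    and \<P> :: "'g set set"
    and K :: "('v, 'e) pre_digraph" and arev :: "'e \<Rightarrow> 'e"
    and \<phi> :: "'g \<Rightarrow> 'v \<Rightarrow> 'v" and \<psi> :: "'g \<Rightarrow> 'e \<Rightarrow> 'e" +
  assumes no_inversions: "\<lbrakk>g \<in> carrier G; a \<in> arcs K\<rbrakk> \<Longrightarrow> \<psi> g a \<noteq> arev a"
    and connected_K: "Digraph_Component.connected K"
    and fine_K: "fine_graph K arev"
    and hyperbolic_K: "hyperbolic_graph K arev"
    and finite_edge_stabilizers: "a \<in> arcs K \<Longrightarrow> finite (stabilizer G \<psi> a)"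
    and finite_edge_orbits: "finite (orbits G (arcs K) \<psi>)"
    and members_stabilizers: "P \<in> \<P> \<Longrightarrow> \<exists>v\<in>verts K. P = stabilizer G \<phi> v"
    and members_nonconjugate:
      "\<lbrakk>P \<in> \<P>; Q \<in> \<P>; P \<noteq> Q\<rbrakk> \<Longrightarrow> \<not> conjugate_in G P Q"
    and infinite_stabilizers_represented:
      "\<lbrakk>v \<in> verts K; infinite (stabilizer G \<phi> v)\<rbrakk> \<Longrightarrow>
         \<exists>P\<in>\<P>. conjugate_in G (stabilizer G \<phi> v) P"

text \<open>
  The type arguments say where the vertices and edges of the witnessing \<open>(G, \<P>)\<close>-graph live; HOL
  cannot quantify over them existentially. As a hypothesis with free type variables,
  \<open>relatively_hyperbolic\<close> asks for a witness over arbitrary types.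
\<close>

definition relatively_hyperbolic ::
  "'v itself \<Rightarrow> 'e itself \<Rightarrow> ('g, 'm) monoid_scheme \<Rightarrow> 'g set set \<Rightarrow> bool"
where
  "relatively_hyperbolic _ _ G \<P> \<longleftrightarrow>
     finite \<P> \<and> (\<forall>P\<in>\<P>. subgroup P G) \<and>
     (\<exists>(K :: ('v, 'e) pre_digraph) arev \<phi> \<psi>. GP_graph G \<P> K arev \<phi> \<psi>)"


subsection \<open>Subgraphs\<close>

text \<open>A subcomplex contains an arc together with its inverse.\<close>

definition subcomplex ::
  "('v, 'e) pre_digraph \<Rightarrow> ('v, 'e) pre_digraph \<Rightarrow> ('e \<Rightarrow> 'e) \<Rightarrow> bool"
where
  "subcomplex L K arev \<longleftrightarrow> subgraph L K \<and> arev ` arcs L \<subseteq> arcs L"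

definition qi_embedded ::
  "('v, 'e) pre_digraph \<Rightarrow> ('v, 'e) pre_digraph \<Rightarrow> ('e \<Rightarrow> 'e) \<Rightarrow> bool"
where
  "qi_embedded L K arev \<longleftrightarrow>
     quasi_isometric_embedding (points L) (path_dist L arev) (points K) (path_dist K arev) (\<lambda>x. x)"

definition invariant_subgraph ::
  "'g set \<Rightarrow> ('v, 'e) pre_digraph \<Rightarrow> ('g \<Rightarrow> 'v \<Rightarrow> 'v) \<Rightarrow> ('g \<Rightarrow> 'e \<Rightarrow> 'e) \<Rightarrow> bool"
where
  "invariant_subgraph H L \<phi> \<psi> \<longleftrightarrow>
     (\<forall>h\<in>H. \<phi> h ` verts L = verts L \<and> \<psi> h ` arcs L = arcs L)"

definition quasiconvexity_witness ::
  "('g, 'm) monoid_scheme \<Rightarrow> 'g set \<Rightarrow> ('v, 'e) pre_digraph \<Rightarrow> ('e \<Rightarrow> 'e) \<Rightarrow>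
   ('g \<Rightarrow> 'v \<Rightarrow> 'v) \<Rightarrow> ('g \<Rightarrow> 'e \<Rightarrow> 'e) \<Rightarrow> ('v, 'e) pre_digraph \<Rightarrow> bool"
where
  "quasiconvexity_witness G H K arev \<phi> \<psi> L \<longleftrightarrow>
     subcomplex L K arev \<and> verts L \<noteq> {} \<and> Digraph_Component.connected L \<and>
     qi_embedded L K arev \<and> invariant_subgraph H L \<phi> \<psi> \<and>
     finite (orbits (G\<lparr>carrier := H\<rparr>) (arcs L) \<psi>)"

end

theory Submission
  imports Defs
begin

text \<open>
  Sending each vertex of \<open>K\<^sub>1\<close> with infinite stabilizer to a vertex of \<open>K\<^sub>2\<close> with the same
  stabilizer, and any other vertex to a finite orbit of its stabilizer in \<open>K\<^sub>2\<close>, gives a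
  coarse \<open>G\<close>-equivariant map \<open>R\<close> from \<open>K\<^sub>1\<close> to \<open>K\<^sub>2\<close>; likewise there is \<open>Q\<close> from \<open>K\<^sub>2\<close> to \<open>K\<^sub>1\<close>.
  By equivariance and finiteness of the numbers of orbits, \<open>R\<close> and \<open>Q\<close> are coarsely Lipschitz and
  \<open>Q \<circ> R\<close> is at bounded distance from the identity. Joining the points of \<open>R u\<close> and \<open>R v\<close>, for
  adjacent \<open>u\<close> and \<open>v\<close> in \<open>L\<^sub>1\<close>, by the \<open>H\<close>-translates of finitely many paths of \<open>K\<^sub>2\<close> yields
  \<open>L\<^sub>2\<close>. A path of \<open>K\<^sub>2\<close> between points of \<open>L\<^sub>2\<close> is carried to \<open>K\<^sub>1\<close> by \<open>Q\<close>, replaced by a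
  path of \<open>L\<^sub>1\<close> of comparable length, and carried to \<open>L\<^sub>2\<close> by \<open>R\<close>.
\<close>

section \<open>Walks of bounded length\<close>

text \<open>Bounds on walk length by natural numbers replace the real-valued path metric. With "at
  most \<open>n\<close>" instead of an exact distance, constants only have to be added, multiplied
  and enlarged, and no infimum occurs.\<close>

definition linked :: "('v, 'e) pre_digraph \<Rightarrow> nat \<Rightarrow> 'v \<Rightarrow> 'v \<Rightarrow> bool" where
  "linked K n x y \<longleftrightarrow> (\<exists>p. pre_digraph.awalk K x p y \<and> length p \<le> n)"

lemma linkedI: "pre_digraph.awalk K x p y \<Longrightarrow> length p \<le> n \<Longrightarrow> linked K n x y"
  by (auto simp: linked_def)

lemma linked_refl: "x \<in> verts K \<Longrightarrow> linked K n x x"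
  by (auto simp: linked_def pre_digraph.awalk_def pre_digraph.cas.simps intro!: exI[of _ "[]"])

lemma linked_mono: "linked K n x y \<Longrightarrow> n \<le> m \<Longrightarrow> linked K m x y"
  by (meson linked_def le_trans)

lemma linked_trans:
  assumes "wf_digraph K" "linked K n x y" "linked K m y z"
  shows "linked K (n + m) x z"
proof -
  interpret wf_digraph K by fact
  obtain p q where "awalk x p y" "length p \<le> n" "awalk y q z" "length q \<le> m"
    using assms by (auto simp: linked_def)
  then show ?thesis
    by (intro linkedI[of _ _ "p @ q"]) auto
qed

text \<open>The clause on \<open>u\<close> covers the empty walk, which has no arc to place it in
  \<open>L\<close>.\<close>

lemma awalk_subgraph_iff:
  assumes "subgraph L K"
  shows "pre_digraph.awalk L u p v \<longleftrightarrow>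
    u \<in> verts L \<and> set p \<subseteq> arcs L \<and> pre_digraph.awalk K u p v"
  using assms compatible_cas[of K L] by (auto simp: subgraph_def pre_digraph.awalk_def)

lemma linked_subgraph: "subgraph L K \<Longrightarrow> linked L n x y \<Longrightarrow> linked K n x y"
  by (auto simp: linked_def awalk_subgraph_iff)

text \<open>Cut the walk just before or just after \<open>b\<close>. This keeps every vertex of a
  chosen walk close to the start of the walk.\<close>

lemma (in wf_digraph) linked_along_walk:
  assumes "awalk u p v" "b \<in> set p"
  shows "linked G (length p) u (tail G b)" "linked G (length p) u (head G b)"
proof -
  obtain q r where p: "p = q @ b # r"
    using assms(2) by (auto simp: in_set_conv_decomp)
  then have "awalk u q (tail G b)" "b \<in> arcs G"
    using assms(1) by (auto simp: awalk_Cons_iff)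
  then show "linked G (length p) u (tail G b)" "linked G (length p) u (head G b)"
    unfolding p
    by (auto simp: awalk_Cons_iff awalk_Nil_iff intro: linkedI[of _ _ q] linkedI[of _ _ "q @ [b]"])
qed

lemma subcomplexD:
  assumes "subcomplex L K arev"
  shows "subgraph L K" "wf_digraph L" "verts L \<subseteq> verts K" "arcs L \<subseteq> arcs K"
    "tail L = tail K" "head L = head K" "a \<in> arcs L \<Longrightarrow> arev a \<in> arcs L"
  using assms by (auto simp: subcomplex_def subgraph_def compatible_def)

context bidirected_digraph
begin

text \<open>Reverse the list of arcs and invert each of them; a subcomplex contains the
  inverses.\<close>

lemma linked_sym:
  assumes L: "subcomplex L G arev" and "linked L n x y"
  shows "linked L n y x"
proof -
  note sub = subcomplexD[OF L]
  interpret L: wf_digraph L by (rule sub)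
  obtain p where p: "L.awalk x p y" "length p \<le> n"
    using assms(2) by (auto simp: linked_def)
  have "L.awalk x p y \<Longrightarrow> L.awalk y (rev (map arev p)) x"
  proof (induction p arbitrary: x)
    case Nil
    then show ?case by (auto simp: L.awalk_Nil_iff)
  next
    case (Cons a p)
    then have a: "a \<in> arcs L" "tail L a = x" and w: "L.awalk (head L a) p y"
      by (auto simp: L.awalk_Cons_iff)
    have "x \<in> verts L" "head L a \<in> verts L"
      using a by auto
    then have "L.awalk (head L a) [arev a] x"
      using a sub by (auto simp: L.awalk_Cons_iff L.awalk_Nil_iff subset_iff)
    then show ?case
      using Cons.IH[OF w] by auto
  qed
  with p show ?thesis by (auto intro: linkedI)
qed

text \<open>Connectedness refers to the symmetric closure of a digraph. Since a subcomplex is closed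
  under \<open>arev\<close>, its arc relation is already symmetric, so directed walks
  suffice.\<close>

lemma connected_iff_linked:
  assumes L: "subcomplex L G arev"
  shows "Digraph_Component.connected L \<longleftrightarrow>
    verts L \<noteq> {} \<and> (\<forall>u\<in>verts L. \<forall>v\<in>verts L. \<exists>n. linked L n u v)"
proof -
  note sub = subcomplexD[OF L]
  interpret L: wf_digraph L by (rule sub)
  have "symmetric L"
    unfolding symmetric_def
  proof (rule symI)
    fix u v assume "(u, v) \<in> arcs_ends L"
    then obtain a where a: "a \<in> arcs L" "u = tail L a" "v = head L a"
      by (auto simp: arcs_ends_def arc_to_ends_def)
    moreover have "tail L (arev a) = v" "head L (arev a) = u"
      using a sub by auto
    ultimately show "(v, u) \<in> arcs_ends L"
      using sub(7)[of a] by (auto simp: arcs_ends_def arc_to_ends_def image_iff intro!: bexI[of _ "arev a"])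
  qed
  then have "Digraph_Component.connected L \<longleftrightarrow>
      verts L \<noteq> {} \<and> (\<forall>u\<in>verts L. \<forall>v\<in>verts L. \<exists>p. L.awalk u p v)"
    by (simp add: connected_def strongly_connected_def L.reachable_mk_symmetric_eq L.reachable_awalk)
  moreover have "(\<exists>n. linked L n u v) \<longleftrightarrow> (\<exists>p. L.awalk u p v)" for u v
    by (auto simp: linked_def)
  ultimately show ?thesis
    by simp
qed

end


section \<open>Distances between points and lengths of walks\<close>

lemma inner_lengths_nonneg: "r \<in> inner_lengths f x y \<Longrightarrow> 0 \<le> r"
  by (induction f x y rule: inner_lengths.induct) (auto split: if_splits)

lemma exits_bounds:
  assumes "x \<in> points K" "(v, r) \<in> exits K x" "wf_digraph K"
  shows "v \<in> verts K" "0 \<le> r"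
  using assms wf_digraph.tail_in_verts wf_digraph.head_in_verts
  by (fastforce simp: points_def)+

lemma path_lengths_nonneg:
  assumes "wf_digraph K" "x \<in> points K" "y \<in> points K" "r \<in> path_lengths K f x y"
  shows "0 \<le> r"
  using assms exits_bounds[OF _ _ assms(1)] inner_lengths_nonneg
  by (fastforce simp: path_lengths_def)

lemma path_dist_le:
  assumes "wf_digraph K" "x \<in> points K" "y \<in> points K" "r \<in> path_lengths K f x y"
  shows "path_dist K f x y \<le> r"
  unfolding path_dist_def
  using assms path_lengths_nonneg[OF assms(1-3)]
  by (intro cInf_lower bdd_belowI[of _ 0])

lemma exits_nonempty: "\<exists>v r. (v, r) \<in> exits K x"
  by (cases x) auto

text \<open>The lower bound of a quasi-isometric embedding, on vertices and with natural constants.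
  The upper bound is automatic, because an inclusion of graphs does not increase distances.\<close>

definition undistorted :: "('v, 'e) pre_digraph \<Rightarrow> ('v, 'e) pre_digraph \<Rightarrow> bool" where
  "undistorted L K \<longleftrightarrow> (\<exists>k c. \<forall>u\<in>verts L. \<forall>v\<in>verts L. \<forall>n.
     linked K n u v \<longrightarrow> linked L (k * n + c) u v)"

text \<open>A point of \<open>L\<close> has the same exits in \<open>L\<close> and in
  \<open>G\<close>. A path of \<open>G\<close> between two such points therefore becomes a path of
  \<open>L\<close> by replacing only its edge path between exits; the end segments stay.\<close>

lemma (in bidirected_digraph) qi_embedded_iff_undistorted:
  assumes L: "subcomplex L G arev" and conn: "Digraph_Component.connected L"
  shows "qi_embedded L G arev \<longleftrightarrow> undistorted L G"
proof -
  note sub = subcomplexD[OF L]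
  interpret L: wf_digraph L by (rule sub)
  have pts: "points L \<subseteq> points G"
    using sub by (auto simp: points_def)
  have ex: "exits L x = exits G x" for x
    using sub by (cases x) auto
  \<comment> \<open>Connectedness of \<open>L\<close> makes the sets of lengths nonempty, so that
    their infima are meaningful.\<close>
  have ne: "path_lengths L arev x y \<noteq> {}" if "x \<in> points L" "y \<in> points L" for x y
  proof -
    obtain v r w s where e: "(v, r) \<in> exits L x" "(w, s) \<in> exits L y"
      using exits_nonempty by metis
    moreover from this that have "v \<in> verts L" "w \<in> verts L"
      using exits_bounds sub by metis+
    then obtain p where "L.awalk v p w"
      using conn connected_iff_linked[OF L] by (auto simp: linked_def)
    ultimately show ?thesis
      unfolding path_lengths_def by blast
  qed
  have incl: "path_lengths L arev x y \<subseteq> path_lengths G arev x y" for x y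
    unfolding path_lengths_def ex using awalk_subgraph_iff[OF sub(1)] by blast
  have contr: "path_dist G arev x y \<le> path_dist L arev x y"
    if "x \<in> points L" "y \<in> points L" for x y
    unfolding path_dist_def
  proof (rule cInf_superset_mono)
    show "bdd_below (path_lengths G arev x y)"
      using that pts path_lengths_nonneg[OF wf_digraph_axioms] by (intro bdd_belowI[of _ 0]) blast
  qed (use that ne incl in auto)
  show ?thesis
  proof
    assume "qi_embedded L G arev"
    then obtain k c :: real where k: "k \<ge> 1" "c \<ge> 0" and
      qi: "\<And>x y. x \<in> points L \<Longrightarrow> y \<in> points L \<Longrightarrow>
            path_dist L arev x y / k - c \<le> path_dist G arev x y"
      unfolding qi_embedded_def quasi_isometric_embedding_def by metis
    have "linked L (nat \<lceil>k\<rceil> * n + nat \<lceil>k * c + 1\<rceil>) u v"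
      if uv: "u \<in> verts L" "v \<in> verts L" and n: "linked G n u v" for u v n
    proof -
      obtain p where p: "awalk u p v" "length p \<le> n"
        using n by (auto simp: linked_def)
      have vp: "Vertex u \<in> points L" "Vertex v \<in> points L"
        using uv by (auto simp: points_def)
      have "real (length p) \<in> path_lengths G arev (Vertex u) (Vertex v)"
        using p(1) by (force simp: path_lengths_def)
      then have "path_dist G arev (Vertex u) (Vertex v) \<le> length p"
        using vp pts by (intro path_dist_le[OF wf_digraph_axioms]) auto
      also have "real (length p) \<le> n"
        using p by simp
      finally have "path_dist L arev (Vertex u) (Vertex v) / k - c \<le> n"
        using qi[OF vp] by simp
      then have "path_dist L arev (Vertex u) (Vertex v) \<le> k * n + k * c"
        using k by (simp add: field_simps)
      \<comment> \<open>The added 1 makes the inequality strict, so that some actual walk has length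
        below the bound.\<close>
      also have "\<dots> < k * n + k * c + 1"
        by simp
      finally have "Inf (path_lengths L arev (Vertex u) (Vertex v)) < k * n + k * c + 1"
        by (simp add: path_dist_def)
      then obtain r where "r \<in> path_lengths L arev (Vertex u) (Vertex v)" "r < k * n + k * c + 1"
        using cInf_lessD[OF ne[OF vp]] by blast
      then obtain q where q: "L.awalk u q v" "length q < k * n + k * c + 1"
        by (auto simp: path_lengths_def)
      have "k * n \<le> nat \<lceil>k\<rceil> * real n"
        by (intro mult_right_mono) linarith+
      moreover have "k * c + 1 \<le> nat \<lceil>k * c + 1\<rceil>"
        by linarith
      ultimately have "real (length q) \<le> real (nat \<lceil>k\<rceil> * n + nat \<lceil>k * c + 1\<rceil>)"
        using q(2) by simp
      then show ?thesis
        using q(1) by (intro linkedI[of L u q]) (simp only: of_nat_le_iff)+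
    qed
    then show "undistorted L G"
      unfolding undistorted_def by blast
  next
    assume "undistorted L G"
    then obtain k c where und: "\<And>u v n. u \<in> verts L \<Longrightarrow> v \<in> verts L \<Longrightarrow> linked G n u v \<Longrightarrow>
        linked L (k * n + c) u v"
      unfolding undistorted_def by blast
    \<comment> \<open>Adding 1 ensures a multiplicative constant of at least 1 even for
      \<open>k = 0\<close>, and absorbs the end segments \<open>r\<close>, \<open>s\<close> and the
      lengths inside a single edge.\<close>
    define k' where "k' = real k + 1"
    have k': "k' \<ge> 1"
      by (simp add: k'_def)
    have expand: "path_dist L arev x y \<le> k' * l + c"
      if xy: "x \<in> points L" "y \<in> points L" and l: "l \<in> path_lengths G arev x y" for x y l
    proof -
      consider (walk) v r p w s where "l = r + real (length p) + s"
          "(v, r) \<in> exits G x" "(w, s) \<in> exits G y" "awalk v p w"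
        | (inner) "l \<in> inner_lengths arev x y"
        using l by (auto simp: path_lengths_def)
      then show ?thesis
      proof cases
        case walk
        have vw: "v \<in> verts L" "w \<in> verts L" "0 \<le> r" "0 \<le> s"
          using walk xy exits_bounds[OF _ _ sub(2)] ex by metis+
        then obtain q where q: "L.awalk v q w" "length q \<le> k * length p + c"
          using und[of v w "length p"] walk linkedI[OF walk(4)] by (auto simp: linked_def)
        have "r + real (length q) + s \<in> path_lengths L arev x y"
          unfolding path_lengths_def ex using walk q(1) by blast
        then have "path_dist L arev x y \<le> r + real (length q) + s"
          using xy by (intro path_dist_le sub(2))
        also have "real (length q) \<le> k * length p + c"
          using q(2) by (metis of_nat_add of_nat_le_iff of_nat_mult)
        finally have "path_dist L arev x y \<le> r + (k * length p + c) + s"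
          by simp
        also have "\<dots> \<le> k' * l + c"
          using vw by (simp add: walk k'_def algebra_simps)
        finally show ?thesis .
      next
        case inner
        then have "path_dist L arev x y \<le> l"
          using xy by (intro path_dist_le sub(2)) (auto simp: path_lengths_def)
        moreover have "0 \<le> k * l"
          using inner_lengths_nonneg[OF inner] by simp
        ultimately show ?thesis
          by (simp add: k'_def algebra_simps)
      qed
    qed
    have "path_dist L arev x y / k' - c \<le> path_dist G arev x y \<and>
        path_dist G arev x y \<le> k' * path_dist L arev x y + c"
      if xy: "x \<in> points L" "y \<in> points L" for x y
    proof
      have "(path_dist L arev x y - c) / k' \<le> Inf (path_lengths G arev x y)"
        using expand[OF xy] k' ne[OF xy] incl[of x y]
        by (intro cInf_greatest) (auto simp: field_simps)
      moreover have "c / k' \<le> real c"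
        using k' mult_right_mono[of 1 k' "real c"] by (simp add: field_simps)
      ultimately show "path_dist L arev x y / k' - c \<le> path_dist G arev x y"
        by (simp add: path_dist_def diff_divide_distrib)
      have "0 \<le> path_dist L arev x y"
        unfolding path_dist_def
        using path_lengths_nonneg[OF sub(2) xy] ne[OF xy] by (intro cInf_greatest)
      then have "path_dist L arev x y \<le> k' * path_dist L arev x y"
        by (simp add: k'_def algebra_simps)
      then show "path_dist G arev x y \<le> k' * path_dist L arev x y + c"
        using contr[OF xy] by simp
    qed
    then show "qi_embedded L G arev"
      unfolding qi_embedded_def quasi_isometric_embedding_def
      using pts k' by (intro conjI exI[of _ k'] exI[of _ "real c"]) auto
  qed
qed

section \<open>Orbits under a subgroup\<close>

text \<open>Finiteness of orbits through representatives. Nothing is asked of \<open>f\<close>, so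
  the notion applies to the diagonal operation on pairs without first making it a group
  action.\<close>

definition orbit_finite :: "'g set \<Rightarrow> ('g \<Rightarrow> 'x \<Rightarrow> 'x) \<Rightarrow> 'x set \<Rightarrow> bool" where
  "orbit_finite H f A \<longleftrightarrow> (\<exists>B\<subseteq>A. finite B \<and> A \<subseteq> (\<Union>h\<in>H. f h ` B))"

context group_action
begin

lemma group_G: "group G"
  using group_hom group_hom.axioms(1) by auto

lemma one_action: "x \<in> E \<Longrightarrow> \<phi> \<one> x = x"
  using id_eq_one by (metis restrict_apply')

lemma inv_action:
  assumes "g \<in> carrier G" "x \<in> E"
  shows "\<phi> g (\<phi> (inv g) x) = x" "\<phi> (inv g) (\<phi> g x) = x"
  using assms composition_rule[symmetric] one_action group_G
  by (simp_all add: group.r_inv group.l_inv group.inv_closed)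

lemma orbit_translate:
  assumes H: "subgroup H G" and "h \<in> H" "x \<in> E"
  shows "orbit (G\<lparr>carrier := H\<rparr>) \<phi> (\<phi> h x) = orbit (G\<lparr>carrier := H\<rparr>) \<phi> x"
proof -
  interpret group G by (rule group_G)
  have HG: "H \<subseteq> carrier G"
    using H by (rule subgroup.subset)
  have sub: "orbit (G\<lparr>carrier := H\<rparr>) \<phi> (\<phi> k y) \<subseteq> orbit (G\<lparr>carrier := H\<rparr>) \<phi> y"
    if "k \<in> H" "y \<in> E" for k y
  proof
    fix z assume "z \<in> orbit (G\<lparr>carrier := H\<rparr>) \<phi> (\<phi> k y)"
    then obtain g where g: "g \<in> H" "z = \<phi> g (\<phi> k y)"
      by (auto simp: orbit_def)
    then have "z = \<phi> (g \<otimes> k) y"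
      using composition_rule[of y g k] subsetD[OF HG] that by simp
    then show "z \<in> orbit (G\<lparr>carrier := H\<rparr>) \<phi> y"
      using subgroup.m_closed[OF H g(1) that(1)] by (auto simp: orbit_def)
  qed
  show ?thesis
  proof
    show "orbit (G\<lparr>carrier := H\<rparr>) \<phi> x \<subseteq> orbit (G\<lparr>carrier := H\<rparr>) \<phi> (\<phi> h x)"
      \<comment> \<open>The reverse inclusion is the one already shown, for \<open>inv h\<close> and
        the point \<open>\<phi> h x\<close>.\<close>
      using sub[of "inv h" "\<phi> h x"] assms HG element_image inv_action(2)
        subgroup.m_inv_closed[OF H] by (metis subsetD)
  qed (use sub assms in blast)
qed

lemma finite_orbits_iff_orbit_finite:
  assumes H: "subgroup H G" and A: "A \<subseteq> E"
  shows "finite (orbits (G\<lparr>carrier := H\<rparr>) A \<phi>) \<longleftrightarrow> orbit_finite H \<phi> A"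
proof -
  let ?o = "orbit (G\<lparr>carrier := H\<rparr>) \<phi>"
  have orbits: "orbits (G\<lparr>carrier := H\<rparr>) A \<phi> = ?o ` A"
    by (auto simp: orbits_def)
  have refl: "a \<in> ?o a" if "a \<in> A" for a
    using that A one_action subgroup.one_closed[OF H] by (force simp: orbit_def)
  show ?thesis
  proof
    assume "finite (orbits (G\<lparr>carrier := H\<rparr>) A \<phi>)"
    then obtain B where B: "B \<subseteq> A" "finite B" "?o ` A = ?o ` B"
      unfolding orbits using finite_subset_image[of "?o ` A" ?o A] by auto
    have "A \<subseteq> (\<Union>h\<in>H. \<phi> h ` B)"
    proof
      fix a assume "a \<in> A"
      then obtain b where "b \<in> B" "?o a = ?o b"
        using B(3) by blast
      then have "a \<in> ?o b"
        using refl \<open>a \<in> A\<close> by blast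
      then show "a \<in> (\<Union>h\<in>H. \<phi> h ` B)"
        using \<open>b \<in> B\<close> by (auto simp: orbit_def)
    qed
    then show "orbit_finite H \<phi> A"
      using B by (auto simp: orbit_finite_def)
  next
    assume "orbit_finite H \<phi> A"
    then obtain B where B: "B \<subseteq> A" "finite B" "A \<subseteq> (\<Union>h\<in>H. \<phi> h ` B)"
      by (auto simp: orbit_finite_def)
    have "?o ` A \<subseteq> ?o ` B"
    proof
      fix O' assume "O' \<in> ?o ` A"
      then obtain h b where "O' = ?o (\<phi> h b)" "h \<in> H" "b \<in> B"
        using B(3) by blast
      then show "O' \<in> ?o ` B"
        using orbit_translate[OF H] B(1) A by blast
    qed
    then show "finite (orbits (G\<lparr>carrier := H\<rparr>) A \<phi>)"
      unfolding orbits using B(2) finite_surj by blast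
  qed
qed

text \<open>Stability under \<open>inv h\<close> supplies the inclusion that stability under
  \<open>h\<close> leaves open.\<close>

lemma invariant_if_stable:
  assumes H: "subgroup H G" and "A \<subseteq> E" and stable: "\<And>h. h \<in> H \<Longrightarrow> \<phi> h ` A \<subseteq> A"
    and h: "h \<in> H"
  shows "\<phi> h ` A = A"
proof
  show "A \<subseteq> \<phi> h ` A"
  proof
    fix a assume "a \<in> A"
    moreover have "\<phi> (inv h) a \<in> A"
      using stable[OF subgroup.m_inv_closed[OF H h]] \<open>a \<in> A\<close> by auto
    moreover have "\<phi> h (\<phi> (inv h) a) = a"
      using inv_action assms \<open>a \<in> A\<close> subgroup.subset[OF H] by blast
    ultimately show "a \<in> \<phi> h ` A"
      by (metis image_eqI)
  qed
qed (rule stable[OF h])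

end

text \<open>
  An equivariant map into \<open>E\<^sub>2\<close> need not exist, since a finite stabilizer may fix no point of
  \<open>E\<^sub>2\<close>; it does however preserve finite sets.
\<close>

lemma equivariant_finite_sets:
  fixes G (structure)
  assumes "group_action G E\<^sub>1 \<phi>\<^sub>1" "group_action G E\<^sub>2 \<phi>\<^sub>2"
    and stab: "\<And>x. x \<in> E\<^sub>1 \<Longrightarrow>
      \<exists>S\<subseteq>E\<^sub>2. finite S \<and> S \<noteq> {} \<and> (\<forall>g\<in>stabilizer G \<phi>\<^sub>1 x. \<phi>\<^sub>2 g ` S \<subseteq> S)"
  obtains R where "\<And>x. x \<in> E\<^sub>1 \<Longrightarrow> R x \<subseteq> E\<^sub>2 \<and> finite (R x) \<and> R x \<noteq> {}"
    and "\<And>g x. g \<in> carrier G \<Longrightarrow> x \<in> E\<^sub>1 \<Longrightarrow> R (\<phi>\<^sub>1 g x) = \<phi>\<^sub>2 g ` R x"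
proof -
  interpret one: group_action G E\<^sub>1 \<phi>\<^sub>1 by fact
  interpret two: group_action G E\<^sub>2 \<phi>\<^sub>2 by fact
  interpret group G by (rule one.group_G)
  obtain S where S: "\<And>x. x \<in> E\<^sub>1 \<Longrightarrow> S x \<subseteq> E\<^sub>2 \<and> finite (S x) \<and> S x \<noteq> {} \<and>
      (\<forall>g\<in>stabilizer G \<phi>\<^sub>1 x. \<phi>\<^sub>2 g ` S x \<subseteq> S x)"
    using stab by metis
  \<comment> \<open>The choice depends on \<open>x\<close> only through its orbit as a set, so all
    points of an orbit share one representative.\<close>
  define rep where "rep x = (SOME r. r \<in> orbit G \<phi>\<^sub>1 x)" for x
  \<comment> \<open>The union over all \<open>g\<close> taking the representative to
    \<open>x\<close> avoids choosing one of them.\<close>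
  define R where "R x = (\<Union>g\<in>{g \<in> carrier G. \<phi>\<^sub>1 g (rep x) = x}. \<phi>\<^sub>2 g ` S (rep x))" for x
  have rep: "rep x \<in> E\<^sub>1" "\<exists>g\<in>carrier G. \<phi>\<^sub>1 g (rep x) = x" if "x \<in> E\<^sub>1" for x
  proof -
    have "rep x \<in> orbit G \<phi>\<^sub>1 x"
      unfolding rep_def using one.orbit_refl[OF that] by (rule someI)
    then obtain g where g: "g \<in> carrier G" "rep x = \<phi>\<^sub>1 g x"
      by (auto simp: orbit_def)
    then show "rep x \<in> E\<^sub>1"
      using one.element_image[OF g(1) that] by simp
    show "\<exists>g\<in>carrier G. \<phi>\<^sub>1 g (rep x) = x"
      using g one.inv_action(2)[OF g(1) that] by (intro bexI[of _ "inv g"]) auto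
  qed
  have rep_translate: "rep (\<phi>\<^sub>1 h x) = rep x" if "x \<in> E\<^sub>1" "h \<in> carrier G" for h x
    unfolding rep_def using one.orbit_translate[OF subgroup_self that(2,1)] by simp
  \<comment> \<open>All members of the union coincide: two such \<open>g\<close> differ by an
    element of the stabilizer of \<open>rep x\<close>, and that stabilizer preserves
    \<open>S (rep x)\<close>.\<close>
  have R: "R x = \<phi>\<^sub>2 g ` S (rep x)" if x: "x \<in> E\<^sub>1" and g: "g \<in> carrier G" "\<phi>\<^sub>1 g (rep x) = x" for x g
  proof -
    have "\<phi>\<^sub>2 k ` S (rep x) \<subseteq> \<phi>\<^sub>2 g ` S (rep x)" if k: "k \<in> carrier G" "\<phi>\<^sub>1 k (rep x) = x" for k
    proof
      fix y assume "y \<in> \<phi>\<^sub>2 k ` S (rep x)"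
      then obtain s where s: "s \<in> S (rep x)" "y = \<phi>\<^sub>2 k s"
        by blast
      have "inv g \<otimes> k \<in> stabilizer G \<phi>\<^sub>1 (rep x)"
        using one.composition_rule[OF rep(1)[OF x], of "inv g" k]
          one.inv_action(2)[OF g(1) rep(1)[OF x]] k g
        by (simp add: stabilizer_def)
      then have "\<phi>\<^sub>2 (inv g \<otimes> k) s \<in> S (rep x)"
        using S rep(1)[OF x] s by blast
      moreover have "\<phi>\<^sub>2 g (\<phi>\<^sub>2 (inv g \<otimes> k) s) = y"
        using two.composition_rule[of s g "inv g \<otimes> k"] s S[OF rep(1)[OF x]] g k
        by (auto simp: m_assoc[symmetric])
      ultimately show "y \<in> \<phi>\<^sub>2 g ` S (rep x)"
        by blast
    qed
    then show ?thesis
      unfolding R_def using g by blast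
  qed
  show ?thesis
  proof
    fix x assume x: "x \<in> E\<^sub>1"
    then obtain g where g: "g \<in> carrier G" "\<phi>\<^sub>1 g (rep x) = x"
      using rep(2) by blast
    show "R x \<subseteq> E\<^sub>2 \<and> finite (R x) \<and> R x \<noteq> {}"
      unfolding R[OF x g] using S[OF rep(1)[OF x]] two.surj_prop[OF g(1)] by auto
  next
    fix h x assume h: "h \<in> carrier G" and x: "x \<in> E\<^sub>1"
    then obtain g where g: "g \<in> carrier G" "\<phi>\<^sub>1 g (rep x) = x"
      using rep(2) by blast
    have "\<phi>\<^sub>1 h x \<in> E\<^sub>1"
      using one.element_image[OF h x] by simp
    moreover have "\<phi>\<^sub>1 (h \<otimes> g) (rep x) = \<phi>\<^sub>1 h x"
      using one.composition_rule[OF rep(1)[OF x] h g(1)] g(2) by simp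
    ultimately have "R (\<phi>\<^sub>1 h x) = \<phi>\<^sub>2 (h \<otimes> g) ` S (rep x)"
      using R[of "\<phi>\<^sub>1 h x" "h \<otimes> g"] h g(1) rep_translate[OF x h] by simp
    also have "\<dots> = \<phi>\<^sub>2 h ` \<phi>\<^sub>2 g ` S (rep x)"
      unfolding image_image
      using S[OF rep(1)[OF x]] two.composition_rule[OF _ h g(1)] by (intro image_cong) blast+
    finally show "R (\<phi>\<^sub>1 h x) = \<phi>\<^sub>2 h ` R x"
      using R[OF x g] by simp
  qed
qed


section \<open>Equivariant coarse maps\<close>

text \<open>A coarse map of graphs is given by the finite sets \<open>R v\<close> of images of the vertices \<open>v\<close>.\<close>

definition image_pairs :: "('v, 'e) pre_digraph \<Rightarrow> ('v \<Rightarrow> 'w set) \<Rightarrow> ('w \<times> 'w) set" where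
  "image_pairs L R =
     (\<Union>u\<in>verts L. R u \<times> R u) \<union> (\<Union>a\<in>arcs L. R (tail L a) \<times> R (head L a))"

lemma Field_image_pairs:
  assumes "wf_digraph L"
  shows "Field (image_pairs L R) = (\<Union>u\<in>verts L. R u)"
proof -
  interpret wf_digraph L by fact
  show ?thesis
    by (fastforce simp: image_pairs_def Field_def)
qed

lemma image_pairs_subset:
  assumes "wf_digraph L" "\<And>u. u \<in> verts L \<Longrightarrow> R u \<subseteq> V"
  shows "image_pairs L R \<subseteq> V \<times> V"
proof -
  interpret wf_digraph L by fact
  show ?thesis
    unfolding image_pairs_def by (intro Un_least UN_least Sigma_mono assms(2)) auto
qed

text \<open>Choose an image point over each intermediate vertex; every arc then costs
  \<open>C\<close>. The final \<open>C\<close> joins two points over the last vertex, since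
  \<open>y\<close> was prescribed.\<close>

lemma linked_image_of_walk:
  assumes L: "wf_digraph L" and M: "wf_digraph M"
    and ne: "\<And>u. u \<in> verts L \<Longrightarrow> R u \<noteq> {}"
    and C: "\<And>x y. (x, y) \<in> image_pairs L R \<Longrightarrow> linked M C x y"
    and "linked L n u v" "x \<in> R u" "y \<in> R v"
  shows "linked M (C * n + C) x y"
proof -
  interpret L: wf_digraph L by fact
  have walk: "linked M (C * length p + C) x y" if "L.awalk u p v" "x \<in> R u" "y \<in> R v" for p u x
    using that
  proof (induction p arbitrary: u x)
    case Nil
    then have "(x, y) \<in> image_pairs L R"
      by (auto simp: L.awalk_Nil_iff image_pairs_def)
    then show ?case
      using C by simp
  next
    case (Cons a p)
    then have a: "a \<in> arcs L" "tail L a = u" and w: "L.awalk (head L a) p v"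
      by (auto simp: L.awalk_Cons_iff)
    then obtain z where z: "z \<in> R (head L a)"
      using ne[of "head L a"] by auto
    then have "(x, z) \<in> image_pairs L R"
      using a Cons.prems by (auto simp: image_pairs_def)
    from linked_trans[OF M C[OF this] Cons.IH[OF w z Cons.prems(3)]]
    show ?case by (simp add: algebra_simps)
  qed
  obtain p where p: "L.awalk u p v" "length p \<le> n"
    using assms(5) by (auto simp: linked_def)
  show ?thesis
    by (rule linked_mono[OF walk[OF p(1) assms(6,7)]]) (simp add: p(2))
qed

text \<open>There are only finitely many pairs over finitely many representatives, and the element
  taking a representative to \<open>a\<close> moves both coordinates at once.\<close>

lemma orbit_finite_UN_times:
  assumes A: "orbit_finite H f A"
    and R: "\<And>h a. h \<in> H \<Longrightarrow> a \<in> A \<Longrightarrow> R (f h a) = k h ` R a"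
    and S: "\<And>h a. h \<in> H \<Longrightarrow> a \<in> A \<Longrightarrow> S (f h a) = k h ` S a"
    and fin: "\<And>a. a \<in> A \<Longrightarrow> finite (R a) \<and> finite (S a)"
  shows "orbit_finite H (\<lambda>h. map_prod (k h) (k h)) (\<Union>a\<in>A. R a \<times> S a)"
proof -
  obtain B where B: "B \<subseteq> A" "finite B" "A \<subseteq> (\<Union>h\<in>H. f h ` B)"
    using A by (auto simp: orbit_finite_def)
  have "(\<Union>a\<in>A. R a \<times> S a) \<subseteq> (\<Union>h\<in>H. map_prod (k h) (k h) ` (\<Union>a\<in>B. R a \<times> S a))"
  proof clarify
    fix a x y assume a: "a \<in> A" and xy: "x \<in> R a" "y \<in> S a"
    then obtain h b where "h \<in> H" "b \<in> B" "a = f h b"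
      using B(3) by blast
    moreover from this xy R S B(1) obtain x' y' where
      "x = k h x'" "x' \<in> R b" "y = k h y'" "y' \<in> S b"
      by blast
    ultimately show "(x, y) \<in> (\<Union>h\<in>H. map_prod (k h) (k h) ` (\<Union>a\<in>B. R a \<times> S a))"
      by (auto intro!: bexI[of _ h] image_eqI[of _ _ "(x', y')"])
  qed
  moreover have "finite (\<Union>a\<in>B. R a \<times> S a)"
    using B fin by auto
  ultimately show ?thesis
    unfolding orbit_finite_def using B(1) by (intro exI[of _ "\<Union>a\<in>B. R a \<times> S a"]) blast
qed

lemma orbit_finite_Un:
  assumes "orbit_finite H f A" "orbit_finite H f B"
  shows "orbit_finite H f (A \<union> B)"
proof -
  obtain A' B' where "A' \<subseteq> A" "finite A'" "A \<subseteq> (\<Union>h\<in>H. f h ` A')"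
    "B' \<subseteq> B" "finite B'" "B \<subseteq> (\<Union>h\<in>H. f h ` B')"
    using assms unfolding orbit_finite_def by metis
  moreover from this have "A \<union> B \<subseteq> (\<Union>h\<in>H. f h ` (A' \<union> B'))"
    unfolding image_Un UN_Un_distrib by (intro Un_mono)
  ultimately show ?thesis
    unfolding orbit_finite_def by (intro exI[of _ "A' \<union> B'"]) auto
qed

section \<open>Subgraphs with finitely many orbits of edges\<close>

context graph_action
begin

text \<open>Fix a vertex \<open>v\<close>. A walk from any \<open>u\<close> to \<open>v\<close> is
  empty or starts with an arc whose tail is \<open>u\<close>, so \<open>v\<close> and the tails of
  the arc representatives suffice.\<close>

lemma orbit_finite_verts:
  assumes H: "subgroup H G" and L: "subcomplex L K arev" "Digraph_Component.connected L"
    and A: "orbit_finite H \<psi> (arcs L)"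
  shows "orbit_finite H \<phi> (verts L)"
proof -
  note sub = subcomplexD[OF L(1)]
  interpret L: wf_digraph L by (rule sub)
  obtain B where B: "B \<subseteq> arcs L" "finite B" "arcs L \<subseteq> (\<Union>h\<in>H. \<psi> h ` B)"
    using A by (auto simp: orbit_finite_def)
  obtain v where v: "v \<in> verts L"
    using connected_iff_linked L by blast
  have "u \<in> (\<Union>h\<in>H. \<phi> h ` insert v (tail K ` B))" if u: "u \<in> verts L" for u
  proof -
    have "\<exists>n. linked L n u v"
      using connected_iff_linked[OF L(1)] L(2) u v by blast
    then obtain p where p: "L.awalk u p v"
      by (auto simp: linked_def)
    show ?thesis
    proof (cases p)
      case Nil
      then have "u = \<phi> \<one> v"
        using p v sub vertex_action.one_action by (auto simp: L.awalk_Nil_iff)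
      then show ?thesis
        using subgroup.one_closed[OF H] by blast
    next
      case (Cons a q)
      then have "a \<in> arcs L" "u = tail K a"
        using p sub by (auto simp: L.awalk_Cons_iff)
      then obtain h b where "h \<in> H" "b \<in> B" "u = tail K (\<psi> h b)"
        using B(3) by blast
      moreover from this have "u = \<phi> h (tail K b)"
        using tail_equivariant subgroup.subset[OF H] B(1) sub by blast
      ultimately show ?thesis
        by blast
    qed
  qed
  moreover have "insert v (tail K ` B) \<subseteq> verts L"
    using v B(1) L.tail_in_verts sub by auto
  ultimately show ?thesis
    unfolding orbit_finite_def using B(2) by (intro exI[of _ "insert v (tail K ` B)"]) blast
qed

text \<open>The arc part of \<open>image_pairs\<close> is covered by the assumption on arcs, the
  vertex part by connectedness. Here \<open>k\<close> stands for the action on the target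
  graph.\<close>

lemma orbit_finite_image_pairs:
  assumes H: "subgroup H G" and L: "subcomplex L K arev" "Digraph_Component.connected L"
    and A: "orbit_finite H \<psi> (arcs L)"
    and R: "\<And>u. u \<in> verts L \<Longrightarrow> finite (R u)"
      "\<And>h u. h \<in> H \<Longrightarrow> u \<in> verts L \<Longrightarrow> R (\<phi> h u) = k h ` R u"
  shows "orbit_finite H (\<lambda>h. map_prod (k h) (k h)) (image_pairs L R)"
proof -
  note sub = subcomplexD[OF L(1)]
  interpret L: wf_digraph L by (rule sub)
  have HG: "H \<subseteq> carrier G"
    using H by (rule subgroup.subset)
  have ends: "tail L (\<psi> h a) = \<phi> h (tail L a)" "head L (\<psi> h a) = \<phi> h (head L a)"
    if "h \<in> H" "a \<in> arcs L" for h a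
  proof -
    have "h \<in> carrier G" "a \<in> arcs K"
      using that HG sub by auto
    then show "tail L (\<psi> h a) = \<phi> h (tail L a)" "head L (\<psi> h a) = \<phi> h (head L a)"
      by (simp_all add: sub tail_equivariant head_equivariant)
  qed
  show ?thesis
    unfolding image_pairs_def
    by (intro orbit_finite_Un orbit_finite_UN_times[OF orbit_finite_verts[OF H L A]]
        orbit_finite_UN_times[OF A]) (auto simp: R ends)
qed

lemma image_pairs_invariant:
  assumes H: "subgroup H G" and L: "subcomplex L K arev"
    and inv: "invariant_subgraph H L \<phi> \<psi>"
    and R: "\<And>h u. h \<in> H \<Longrightarrow> u \<in> verts L \<Longrightarrow> R (\<phi> h u) = k h ` R u"
    and "h \<in> H" "(x, y) \<in> image_pairs L R"
  shows "(k h x, k h y) \<in> image_pairs L R"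
proof -
  note sub = subcomplexD[OF L]
  interpret L: wf_digraph L by (rule sub)
  have h: "h \<in> carrier G"
    using assms subgroup.subset by blast
  consider u where "u \<in> verts L" "x \<in> R u" "y \<in> R u"
    | a where "a \<in> arcs L" "x \<in> R (tail L a)" "y \<in> R (head L a)"
    using assms(6) by (auto simp: image_pairs_def)
  then show ?thesis
  proof cases
    case 1
    then have "\<phi> h u \<in> verts L" "k h x \<in> R (\<phi> h u)" "k h y \<in> R (\<phi> h u)"
      using inv R \<open>h \<in> H\<close> unfolding invariant_subgraph_def by blast+
    then show ?thesis
      by (auto simp: image_pairs_def)
  next
    case 2
    then have "\<psi> h a \<in> arcs L"
      using inv \<open>h \<in> H\<close> unfolding invariant_subgraph_def by blast
    moreover have "tail L (\<psi> h a) = \<phi> h (tail L a)" "head L (\<psi> h a) = \<phi> h (head L a)"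
      using 2 h sub(4) by (auto simp: sub(5,6) tail_equivariant head_equivariant)
    ultimately show ?thesis
      using 2 R \<open>h \<in> H\<close> by (auto simp: image_pairs_def intro!: bexI[of _ "\<psi> h a"])
  qed
qed

lemma awalk_translate:
  assumes "g \<in> carrier G" "awalk x p y"
  shows "awalk (\<phi> g x) (map (\<psi> g) p) (\<phi> g y)"
  using assms(2)
proof (induction p arbitrary: x)
  case Nil
  then show ?case
    using assms(1) vertex_action.element_image by (auto simp: awalk_Nil_iff)
next
  case (Cons a p)
  then have a: "a \<in> arcs K" "tail K a = x" and w: "awalk (head K a) p y"
    by (auto simp: awalk_Cons_iff)
  have "\<psi> g a \<in> arcs K"
    using arc_action.element_image[OF assms(1) a(1)] by simp
  then show ?case
    using Cons.IH[OF w] a assms(1)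
    by (simp add: awalk_Cons_iff tail_equivariant head_equivariant)
qed

text \<open>Choose a walk of \<open>K\<close> for each of finitely many representatives of
  \<open>T\<close> and take all \<open>H\<close>-translates. Translation preserves length, so one
  \<open>C\<close> serves every pair. For a subgroup \<open>H\<close> this constructs the new
  subgraph; for the whole group it yields uniform bounds.\<close>

lemma subcomplex_linking_pairs:
  assumes conn: "Digraph_Component.connected K" and H: "subgroup H G"
    and T: "T \<subseteq> verts K \<times> verts K" "orbit_finite H (\<lambda>h. map_prod (\<phi> h) (\<phi> h)) T"
    and T_inv: "\<And>h x y. h \<in> H \<Longrightarrow> (x, y) \<in> T \<Longrightarrow> (\<phi> h x, \<phi> h y) \<in> T"
  obtains M C where "subcomplex M K arev" "invariant_subgraph H M \<phi> \<psi>"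
    "orbit_finite H \<psi> (arcs M)" "Field T \<subseteq> verts M"
    "\<And>x y. (x, y) \<in> T \<Longrightarrow> linked M C x y"
    "\<And>z. z \<in> verts M \<Longrightarrow> \<exists>x\<in>Field T. linked M C x z"
proof -
  have HG: "h \<in> carrier G" if "h \<in> H" for h
    using that H subgroup.subset by blast
  obtain B where B: "B \<subseteq> T" "finite B" "T \<subseteq> (\<Union>h\<in>H. map_prod (\<phi> h) (\<phi> h) ` B)"
    using T(2) by (auto simp: orbit_finite_def)
  have K: "subcomplex K K arev"
    using wf_digraph_axioms by (auto simp: subcomplex_def subgraph_def compatible_def)
  have "\<exists>p. awalk (fst t) p (snd t)" if "t \<in> B" for t
  proof -
    have "fst t \<in> verts K" "snd t \<in> verts K"
      using that B(1) T(1) by auto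
    then show ?thesis
      using conn connected_iff_linked[OF K] unfolding linked_def by blast
  qed
  then obtain p where p: "\<And>t. t \<in> B \<Longrightarrow> awalk (fst t) (p t) (snd t)"
    by metis
  \<comment> \<open>The inverse arcs are included to obtain a subcomplex; as \<open>arev\<close>
    commutes with the action, the translates are again closed under it.\<close>
  define F where "F = (\<Union>t\<in>B. set (p t)) \<union> arev ` (\<Union>t\<in>B. set (p t))"
  define A where "A = (\<Union>h\<in>H. \<psi> h ` F)"
  \<comment> \<open>\<open>Field T\<close> is added explicitly because an empty walk contributes no
    arc from which its vertex could be recovered.\<close>
  define M where "M = K\<lparr>verts := Field T \<union> tail K ` A \<union> head K ` A, arcs := A\<rparr>"
  define C where "C = (\<Sum>t\<in>B. length (p t))"
  have len: "length (p t) \<le> C" if "t \<in> B" for t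
    unfolding C_def using that B(2) by (intro member_le_sum) auto
  have M_simps: "verts M = Field T \<union> tail K ` A \<union> head K ` A" "arcs M = A"
    "tail M = tail K" "head M = head K"
    by (simp_all add: M_def)
  have FK: "F \<subseteq> arcs K"
    unfolding F_def using p by (auto simp: awalk_def subset_iff)
  have AK: "A \<subseteq> arcs K"
    unfolding A_def using FK HG arc_action.element_image by blast
  have "finite F"
    using B(2) by (auto simp: F_def)
  moreover have "F \<subseteq> A"
    unfolding A_def using FK arc_action.one_action subgroup.one_closed[OF H] by force
  ultimately have A_finite: "orbit_finite H \<psi> (arcs M)"
    by (auto simp: orbit_finite_def M_simps A_def)
  have rev_F: "arev b \<in> F" if "b \<in> F" for b
    using that by (auto simp: F_def)
  have rev_A: "arev a \<in> A" if "a \<in> A" for a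
  proof -
    obtain h b where hb: "h \<in> H" "b \<in> F" "a = \<psi> h b"
      using \<open>a \<in> A\<close> by (auto simp: A_def)
    then have "arev a = \<psi> h (arev b)"
      using arev_equivariant[of h b] HG FK by auto
    then show ?thesis
      using hb rev_F unfolding A_def by blast
  qed
  have M_wf: "wf_digraph M"
    by unfold_locales (auto simp: M_simps)
  interpret M: wf_digraph M by (rule M_wf)
  have "verts M \<subseteq> verts K"
    using T(1) AK by (auto simp: M_simps Field_def)
  then have M: "subcomplex M K arev"
    using M_wf AK rev_A wf_digraph_axioms
    by (auto simp: subcomplex_def subgraph_def compatible_def M_simps)
  have A_stable: "\<psi> h a \<in> A" if h: "h \<in> H" and "a \<in> A" for h a
  proof -
    obtain k b where kb: "k \<in> H" "b \<in> F" "a = \<psi> k b"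
      using \<open>a \<in> A\<close> by (auto simp: A_def)
    then have "\<psi> h a = \<psi> (h \<otimes> k) b"
      using arc_action.composition_rule[of b h k] HG h FK by auto
    then show ?thesis
      using kb subgroup.m_closed[OF H h] by (auto simp: A_def)
  qed
  have V_stable: "\<phi> h x \<in> verts M" if h: "h \<in> H" and "x \<in> verts M" for h x
  proof -
    consider "x \<in> Field T" | a where "a \<in> A" "x = tail K a" | a where "a \<in> A" "x = head K a"
      using \<open>x \<in> verts M\<close> by (auto simp: M_simps)
    then show ?thesis
    proof cases
      case 1
      then have "\<phi> h x \<in> Field T"
        using T_inv[OF h] by (auto simp: Field_def)
      then show ?thesis
        by (simp add: M_simps)
    next
      case 2
      then have "\<phi> h x = tail K (\<psi> h a)"
        using tail_equivariant AK HG[OF h] by auto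
      then show ?thesis
        using A_stable[OF h] 2 by (auto simp: M_simps)
    next
      case 3
      then have "\<phi> h x = head K (\<psi> h a)"
        using head_equivariant AK HG[OF h] by auto
      then show ?thesis
        using A_stable[OF h] 3 by (auto simp: M_simps)
    qed
  qed
  have M_inv: "invariant_subgraph H M \<phi> \<psi>"
    unfolding invariant_subgraph_def
    using vertex_action.invariant_if_stable[OF H \<open>verts M \<subseteq> verts K\<close>] V_stable
      arc_action.invariant_if_stable[OF H AK] A_stable
    by (auto simp: M_simps(2) image_subset_iff)
  have walk: "M.awalk (\<phi> h (fst t)) (map (\<psi> h) (p t)) (\<phi> h (snd t))"
    if "h \<in> H" "t \<in> B" for h t
  proof -
    have "fst t \<in> Field T"
      using \<open>t \<in> B\<close> B(1) by (cases t) (auto simp: Field_def)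
    then have "\<phi> h (fst t) \<in> verts M"
      using V_stable that by (auto simp: M_simps)
    moreover have "set (map (\<psi> h) (p t)) \<subseteq> arcs M"
      using that by (auto simp: M_simps A_def F_def)
    ultimately show ?thesis
      unfolding awalk_subgraph_iff[OF subcomplexD(1)[OF M]]
      by (intro conjI awalk_translate HG p that)
  qed
  \<comment> \<open>Up to inversion, which only exchanges the ends, \<open>a\<close> lies on a
    translated walk of length at most \<open>C\<close>. That walk starts in \<open>Field T\<close>
    because \<open>T\<close> is stable under \<open>H\<close>.\<close>
  have near: "\<exists>x\<in>Field T. linked M C x (tail M a) \<and> linked M C x (head M a)" if "a \<in> A" for a
  proof -
    obtain h b t where hbt: "h \<in> H" "t \<in> B" "b \<in> set (p t)" "a = \<psi> h b \<or> a = \<psi> h (arev b)"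
      using \<open>a \<in> A\<close> by (auto simp: A_def F_def)
    let ?x = "\<phi> h (fst t)"
    have "(\<phi> h (fst t), \<phi> h (snd t)) \<in> T"
      using T_inv hbt B(1) by auto
    then have "?x \<in> Field T"
      by (auto simp: Field_def)
    moreover have "\<psi> h b \<in> set (map (\<psi> h) (p t))" "length (map (\<psi> h) (p t)) \<le> C"
      using hbt len by auto
    then have "linked M C ?x (tail M (\<psi> h b))" "linked M C ?x (head M (\<psi> h b))"
      using M.linked_along_walk[OF walk[OF hbt(1,2)]] linked_mono by metis+
    moreover have "b \<in> arcs K"
      using FK hbt by (auto simp: F_def)
    then have "tail M (\<psi> h (arev b)) = head M (\<psi> h b)" "head M (\<psi> h (arev b)) = tail M (\<psi> h b)"
      using HG[OF hbt(1)] arev_equivariant[of h b] arc_action.element_image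
      by (auto simp: M_simps)
    ultimately show ?thesis
      using hbt(4) by auto
  qed
  show ?thesis
  proof
    show "subcomplex M K arev" "invariant_subgraph H M \<phi> \<psi>" "orbit_finite H \<psi> (arcs M)"
      by fact+
    show "Field T \<subseteq> verts M"
      by (auto simp: M_simps)
    show "linked M C x y" if "(x, y) \<in> T" for x y
    proof -
      obtain h t where ht: "h \<in> H" "t \<in> B" "(x, y) = map_prod (\<phi> h) (\<phi> h) t"
        using subsetD[OF B(3) \<open>(x, y) \<in> T\<close>] by (elim UN_E imageE)
      then have "x = \<phi> h (fst t)" "y = \<phi> h (snd t)"
        by (cases t; simp)+
      then show ?thesis
        using linkedI[OF walk[OF ht(1,2)], of C] len[OF ht(2)] by simp
    qed
    show "\<exists>x\<in>Field T. linked M C x z" if "z \<in> verts M" for z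
    proof -
      consider "z \<in> Field T" | a where "a \<in> A" "z = tail M a \<or> z = head M a"
        using \<open>z \<in> verts M\<close> by (auto simp: M_simps)
      then show ?thesis
      proof cases
        case 1
        then show ?thesis
          using linked_refl[OF \<open>z \<in> verts M\<close>] by blast
      next
        case 2
        then show ?thesis
          using near by blast
      qed
    qed
  qed
qed

end


section \<open>Uniform bounds and the comparison of two \<open>(G, \<P>)\<close>-graphs\<close>

context GP_graph
begin

lemma subcomplex_self: "subcomplex K K arev"
  using wf_digraph_axioms by (auto simp: subcomplex_def subgraph_def compatible_def)

lemma orbit_finite_arcs: "orbit_finite (carrier G) \<psi> (arcs K)"
  using finite_edge_orbits arc_action.finite_orbits_iff_orbit_finite[OF subgroup_self] by simp

lemma invariant_self: "invariant_subgraph (carrier G) K \<phi> \<psi>"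
  using vertex_action.surj_prop arc_action.surj_prop by (auto simp: invariant_subgraph_def)

text \<open>The bound is the one for the subgraph built from \<open>T\<close> with the whole group
  acting; the subgraph itself is then forgotten.\<close>

lemma bounded_on_orbit_finite_pairs:
  assumes "T \<subseteq> verts K \<times> verts K" "orbit_finite (carrier G) (\<lambda>g. map_prod (\<phi> g) (\<phi> g)) T"
    "\<And>g x y. g \<in> carrier G \<Longrightarrow> (x, y) \<in> T \<Longrightarrow> (\<phi> g x, \<phi> g y) \<in> T"
  shows "\<exists>C. \<forall>(x, y)\<in>T. linked K C x y"
proof -
  obtain M C where M: "subcomplex M K arev" and "\<And>x y. (x, y) \<in> T \<Longrightarrow> linked M C x y"
    using subcomplex_linking_pairs[OF connected_K subgroup_self assms] by metis
  then show ?thesis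
    using linked_subgraph[OF subcomplexD(1)[OF M]] by blast
qed

end

text \<open>This is where \<open>\<P>\<close> ties the two graphs together. An infinite stabilizer
  is a conjugate by \<open>g\<close> of some \<open>P\<close> in \<open>\<P>\<close>, and
  \<open>P\<close> is also the stabilizer of a vertex \<open>w\<close> of \<open>K\<^sub>2\<close>,
  so the translate of \<open>w\<close> by \<open>g\<close> is fixed. A finite stabilizer preserves
  its orbit of any vertex.\<close>

lemma stabilizer_preserves_finite_set:
  assumes one: "GP_graph G \<P> K\<^sub>1 arev\<^sub>1 \<phi>\<^sub>1 \<psi>\<^sub>1" and two: "GP_graph G \<P> K\<^sub>2 arev\<^sub>2 \<phi>\<^sub>2 \<psi>\<^sub>2"
    and v: "v \<in> verts K\<^sub>1"
  shows "\<exists>S\<subseteq>verts K\<^sub>2. finite S \<and> S \<noteq> {} \<and> (\<forall>g\<in>stabilizer G \<phi>\<^sub>1 v. \<phi>\<^sub>2 g ` S \<subseteq> S)"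
proof -
  interpret one: GP_graph G \<P> K\<^sub>1 arev\<^sub>1 \<phi>\<^sub>1 \<psi>\<^sub>1 by fact
  interpret two: GP_graph G \<P> K\<^sub>2 arev\<^sub>2 \<phi>\<^sub>2 \<psi>\<^sub>2 by fact
  show ?thesis
  proof (cases "finite (stabilizer G \<phi>\<^sub>1 v)")
    case True
    obtain w where w: "w \<in> verts K\<^sub>2"
      using two.connected_K two.connected_iff_linked[OF two.subcomplex_self] by blast
    let ?S = "(\<lambda>s. \<phi>\<^sub>2 s w) ` stabilizer G \<phi>\<^sub>1 v"
    have stab: "s \<in> carrier G" if "s \<in> stabilizer G \<phi>\<^sub>1 v" for s
      using that one.vertex_action.stabilizer_subset by blast
    have "\<phi>\<^sub>2 g (\<phi>\<^sub>2 s w) \<in> ?S" if "g \<in> stabilizer G \<phi>\<^sub>1 v" "s \<in> stabilizer G \<phi>\<^sub>1 v" for g s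
      using one.vertex_action.stabilizer_m_closed[OF v that]
        two.vertex_action.composition_rule[OF w] stab that by (metis image_eqI)
    moreover have "?S \<subseteq> verts K\<^sub>2"
      using stab w two.vertex_action.element_image by blast
    moreover have "?S \<noteq> {}"
      using one.vertex_action.stabilizer_one_closed[OF v] by blast
    ultimately show ?thesis
      using True by (intro exI[of _ ?S]) auto
  next
    case False
    then obtain P where P: "P \<in> \<P>" "conjugate_in G (stabilizer G \<phi>\<^sub>1 v) P"
      using one.infinite_stabilizers_represented v by blast
    obtain w where w: "w \<in> verts K\<^sub>2" "P = stabilizer G \<phi>\<^sub>2 w"
      using two.members_stabilizers P(1) by blast
    obtain g where g: "g \<in> carrier G" "stabilizer G \<phi>\<^sub>1 v = g <#\<^bsub>G\<^esub> (P #>\<^bsub>G\<^esub> inv\<^bsub>G\<^esub> g)"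
      using P(2) by (auto simp: conjugate_in_def)
    have gw: "\<phi>\<^sub>2 g w \<in> verts K\<^sub>2"
      using two.vertex_action.element_image g w by blast
    have "\<phi>\<^sub>2 s (\<phi>\<^sub>2 g w) = \<phi>\<^sub>2 g w" if s: "s \<in> stabilizer G \<phi>\<^sub>1 v" for s
    proof -
      obtain p where p: "p \<in> P" "s = g \<otimes>\<^bsub>G\<^esub> (p \<otimes>\<^bsub>G\<^esub> inv\<^bsub>G\<^esub> g)"
        using s unfolding g(2) l_coset_def r_coset_def by blast
      have pG: "p \<in> carrier G" "\<phi>\<^sub>2 p w = w"
        using p(1) w(2) by (auto simp: stabilizer_def)
      show ?thesis
        unfolding p(2)
        using pG g(1) w(1) gw
        by (simp add: two.vertex_action.composition_rule two.vertex_action.inv_action)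
    qed
    then show ?thesis
      using gw by (intro exI[of _ "{\<phi>\<^sub>2 g w}"]) auto
  qed
qed

lemma coarse_map:
  assumes "GP_graph G \<P> K\<^sub>1 arev\<^sub>1 \<phi>\<^sub>1 \<psi>\<^sub>1" "GP_graph G \<P> K\<^sub>2 arev\<^sub>2 \<phi>\<^sub>2 \<psi>\<^sub>2"
  obtains R where "\<And>v. v \<in> verts K\<^sub>1 \<Longrightarrow> R v \<subseteq> verts K\<^sub>2 \<and> finite (R v) \<and> R v \<noteq> {}"
    and "\<And>g v. g \<in> carrier G \<Longrightarrow> v \<in> verts K\<^sub>1 \<Longrightarrow> R (\<phi>\<^sub>1 g v) = \<phi>\<^sub>2 g ` R v"
proof -
  interpret one: GP_graph G \<P> K\<^sub>1 arev\<^sub>1 \<phi>\<^sub>1 \<psi>\<^sub>1 by fact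
  interpret two: GP_graph G \<P> K\<^sub>2 arev\<^sub>2 \<phi>\<^sub>2 \<psi>\<^sub>2 by fact
  show ?thesis
    by (rule equivariant_finite_sets[OF one.vertex_action.group_action_axioms
          two.vertex_action.group_action_axioms stabilizer_preserves_finite_set[OF assms]])
      (use that in blast)+
qed

section \<open>Transfer of the quasiconvex subgraph\<close>

theorem theorem1p4:
  fixes G :: "('g, 'm) monoid_scheme" and \<P> :: "'g set set" and H :: "'g set"
    and K\<^sub>1 :: "('v1, 'e1) pre_digraph" and K\<^sub>2 :: "('v2, 'e2) pre_digraph"
  assumes "group G"
    and "relatively_hyperbolic TYPE('v0) TYPE('e0) G \<P>"
    and "subgroup H G"
    and "GP_graph G \<P> K\<^sub>1 arev\<^sub>1 \<phi>\<^sub>1 \<psi>\<^sub>1"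
    and "GP_graph G \<P> K\<^sub>2 arev\<^sub>2 \<phi>\<^sub>2 \<psi>\<^sub>2"
    and "\<exists>L\<^sub>1. quasiconvexity_witness G H K\<^sub>1 arev\<^sub>1 \<phi>\<^sub>1 \<psi>\<^sub>1 L\<^sub>1"
  shows "\<exists>L\<^sub>2. quasiconvexity_witness G H K\<^sub>2 arev\<^sub>2 \<phi>\<^sub>2 \<psi>\<^sub>2 L\<^sub>2"
proof -
  interpret one: GP_graph G \<P> K\<^sub>1 arev\<^sub>1 \<phi>\<^sub>1 \<psi>\<^sub>1 by fact
  interpret two: GP_graph G \<P> K\<^sub>2 arev\<^sub>2 \<phi>\<^sub>2 \<psi>\<^sub>2 by fact
  note H = \<open>subgroup H G\<close>
  have HG: "h \<in> carrier G" if "h \<in> H" for h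
    using that H subgroup.subset by blast
  obtain L\<^sub>1 where L\<^sub>1: "subcomplex L\<^sub>1 K\<^sub>1 arev\<^sub>1" "Digraph_Component.connected L\<^sub>1"
      "qi_embedded L\<^sub>1 K\<^sub>1 arev\<^sub>1" "invariant_subgraph H L\<^sub>1 \<phi>\<^sub>1 \<psi>\<^sub>1"
      "finite (orbits (G\<lparr>carrier := H\<rparr>) (arcs L\<^sub>1) \<psi>\<^sub>1)"
    using assms(6) unfolding quasiconvexity_witness_def by blast
  note sub1 = subcomplexD[OF L\<^sub>1(1)]
  have fin1: "orbit_finite H \<psi>\<^sub>1 (arcs L\<^sub>1)"
    using L\<^sub>1(5) one.arc_action.finite_orbits_iff_orbit_finite[OF H sub1(4)] by blast
  obtain k c where kc: "\<And>u v n. u \<in> verts L\<^sub>1 \<Longrightarrow> v \<in> verts L\<^sub>1 \<Longrightarrow> linked K\<^sub>1 n u v \<Longrightarrow>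
      linked L\<^sub>1 (k * n + c) u v"
    using L\<^sub>1(3) unfolding one.qi_embedded_iff_undistorted[OF L\<^sub>1(1,2)] undistorted_def by metis
  obtain R where R: "\<And>v. v \<in> verts K\<^sub>1 \<Longrightarrow> R v \<subseteq> verts K\<^sub>2 \<and> finite (R v) \<and> R v \<noteq> {}"
    and R_eq: "\<And>g v. g \<in> carrier G \<Longrightarrow> v \<in> verts K\<^sub>1 \<Longrightarrow> R (\<phi>\<^sub>1 g v) = \<phi>\<^sub>2 g ` R v"
    using coarse_map[OF assms(4,5)] by metis
  obtain Q where Q: "\<And>v. v \<in> verts K\<^sub>2 \<Longrightarrow> Q v \<subseteq> verts K\<^sub>1 \<and> finite (Q v) \<and> Q v \<noteq> {}"
    and Q_eq: "\<And>g v. g \<in> carrier G \<Longrightarrow> v \<in> verts K\<^sub>2 \<Longrightarrow> Q (\<phi>\<^sub>2 g v) = \<phi>\<^sub>1 g ` Q v"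
    using coarse_map[OF assms(5,4)] by metis

  \<comment> \<open>\<open>B\<close> is the coarse Lipschitz constant of \<open>Q\<close> on all of
    \<open>K\<^sub>2\<close>. For \<open>R\<close> only its restriction to \<open>L\<^sub>1\<close>
    is used, and there \<open>C\<close> below plays this role.\<close>
  have "image_pairs K\<^sub>2 Q \<subseteq> verts K\<^sub>1 \<times> verts K\<^sub>1"
    by (rule image_pairs_subset[OF two.wf_digraph_axioms]) (use Q in blast)
  moreover have "orbit_finite (carrier G) (\<lambda>g. map_prod (\<phi>\<^sub>1 g) (\<phi>\<^sub>1 g)) (image_pairs K\<^sub>2 Q)"
    by (rule two.orbit_finite_image_pairs[OF one.subgroup_self two.subcomplex_self
          two.connected_K two.orbit_finite_arcs]) (use Q Q_eq in blast)+
  moreover have "(\<phi>\<^sub>1 g x, \<phi>\<^sub>1 g y) \<in> image_pairs K\<^sub>2 Q"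
    if "g \<in> carrier G" "(x, y) \<in> image_pairs K\<^sub>2 Q" for g x y
    by (rule two.image_pairs_invariant[OF one.subgroup_self two.subcomplex_self
          two.invariant_self Q_eq that])
  ultimately have "\<exists>B. \<forall>(x, y)\<in>image_pairs K\<^sub>2 Q. linked K\<^sub>1 B x y"
    by (rule one.bounded_on_orbit_finite_pairs)
  then obtain B where B: "\<And>x y. (x, y) \<in> image_pairs K\<^sub>2 Q \<Longrightarrow> linked K\<^sub>1 B x y"
    by blast

  \<comment> \<open>\<open>D\<close> is the graph of the coarse map \<open>Q \<circ> R\<close>; a
    bound on it says that this map moves vertices by at most \<open>d\<close>. The singleton factor
    puts \<open>D\<close> in the form of \<open>orbit_finite_UN_times\<close>.\<close>
  define D where "D = (\<Union>u\<in>verts K\<^sub>1. {u} \<times> (\<Union>x\<in>R u. Q x))"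
  have QR_eq: "(\<Union>x\<in>R (\<phi>\<^sub>1 g u). Q x) = \<phi>\<^sub>1 g ` (\<Union>x\<in>R u. Q x)"
    if "g \<in> carrier G" "u \<in> verts K\<^sub>1" for g u
  proof -
    have "Q (\<phi>\<^sub>2 g x) = \<phi>\<^sub>1 g ` Q x" if "x \<in> R u" for x
      using Q_eq \<open>g \<in> carrier G\<close> R[OF \<open>u \<in> verts K\<^sub>1\<close>] that by blast
    then show ?thesis
      by (simp add: R_eq[OF that] image_UN)
  qed
  have QR_fin: "finite (\<Union>x\<in>R u. Q x)" if "u \<in> verts K\<^sub>1" for u
    using R[OF that] Q by blast
  have "D \<subseteq> verts K\<^sub>1 \<times> verts K\<^sub>1"
    using R Q unfolding D_def by blast
  moreover have "orbit_finite (carrier G) (\<lambda>g. map_prod (\<phi>\<^sub>1 g) (\<phi>\<^sub>1 g)) D"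
    unfolding D_def
    by (intro orbit_finite_UN_times[OF one.orbit_finite_verts[OF one.subgroup_self
            one.subcomplex_self one.connected_K one.orbit_finite_arcs]])
      (use QR_eq QR_fin in auto)
  moreover have "(\<phi>\<^sub>1 g x, \<phi>\<^sub>1 g y) \<in> D" if "g \<in> carrier G" "(x, y) \<in> D" for g x y
  proof -
    have x: "x \<in> verts K\<^sub>1" and y: "y \<in> (\<Union>x\<in>R x. Q x)"
      using that by (auto simp: D_def)
    have "\<phi>\<^sub>1 g x \<in> verts K\<^sub>1"
      using one.vertex_action.element_image[OF that(1) x] by simp
    moreover have "\<phi>\<^sub>1 g y \<in> (\<Union>x\<in>R (\<phi>\<^sub>1 g x). Q x)"
      unfolding QR_eq[OF that(1) x] using y by (rule imageI)
    ultimately show ?thesis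
      by (auto simp: D_def)
  qed
  ultimately have "\<exists>d. \<forall>(x, y)\<in>D. linked K\<^sub>1 d x y"
    by (rule one.bounded_on_orbit_finite_pairs)
  then obtain d where d: "\<And>x y. (x, y) \<in> D \<Longrightarrow> linked K\<^sub>1 d x y"
    by blast
  have d: "linked K\<^sub>1 d u u'" "linked K\<^sub>1 d u' u" if "u \<in> verts K\<^sub>1" "x \<in> R u" "u' \<in> Q x" for u x u'
  proof -
    have "(u, u') \<in> D"
      using that by (auto simp: D_def)
    then show "linked K\<^sub>1 d u u'"
      by (rule d)
    then show "linked K\<^sub>1 d u' u"
      by (rule one.linked_sym[OF one.subcomplex_self])
  qed

  \<comment> \<open>These are the pairs that \<open>L\<^sub>2\<close> has to connect. They come from
    \<open>L\<^sub>1\<close> and not from \<open>K\<^sub>1\<close>, so that finitely many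
    \<open>H\<close>-orbits cover them.\<close>
  define T where "T = image_pairs L\<^sub>1 R"
  have Field_T: "Field T = (\<Union>u\<in>verts L\<^sub>1. R u)"
    unfolding T_def by (rule Field_image_pairs[OF sub1(2)])
  have RL: "R u \<subseteq> verts K\<^sub>2" "finite (R u)" "R u \<noteq> {}" if "u \<in> verts L\<^sub>1" for u
    using R sub1(3) that by auto
  have RL_eq: "R (\<phi>\<^sub>1 h u) = \<phi>\<^sub>2 h ` R u" if "h \<in> H" "u \<in> verts L\<^sub>1" for h u
    using R_eq HG sub1(3) that by blast
  have "Field T \<subseteq> verts K\<^sub>2"
    using RL Field_T by blast
  then have T_K: "T \<subseteq> verts K\<^sub>2 \<times> verts K\<^sub>2"
    by (auto simp: Field_def)
  have T_fin: "orbit_finite H (\<lambda>h. map_prod (\<phi>\<^sub>2 h) (\<phi>\<^sub>2 h)) T"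
    unfolding T_def by (rule one.orbit_finite_image_pairs[OF H L\<^sub>1(1,2) fin1 RL(2) RL_eq])
  have T_inv: "(\<phi>\<^sub>2 h x, \<phi>\<^sub>2 h y) \<in> T" if "h \<in> H" "(x, y) \<in> T" for h x y
    unfolding T_def
    by (rule one.image_pairs_invariant[OF H L\<^sub>1(1,4) RL_eq that[unfolded T_def]])
  obtain L\<^sub>2 C where L\<^sub>2: "subcomplex L\<^sub>2 K\<^sub>2 arev\<^sub>2" "invariant_subgraph H L\<^sub>2 \<phi>\<^sub>2 \<psi>\<^sub>2"
      "orbit_finite H \<psi>\<^sub>2 (arcs L\<^sub>2)" "Field T \<subseteq> verts L\<^sub>2"
    and C: "\<And>x y. (x, y) \<in> T \<Longrightarrow> linked L\<^sub>2 C x y"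
    and near: "\<And>z. z \<in> verts L\<^sub>2 \<Longrightarrow> \<exists>x\<in>Field T. linked L\<^sub>2 C x z"
    using two.subcomplex_linking_pairs[OF two.connected_K H T_K T_fin T_inv] by metis
  note sub2 = subcomplexD[OF L\<^sub>2(1)]
  \<comment> \<open>Vertices of \<open>L\<^sub>2\<close> are thus traded, at cost \<open>C\<close>,
    for image points of vertices of \<open>L\<^sub>1\<close>.\<close>
  have anchor: "\<exists>u\<in>verts L\<^sub>1. \<exists>x\<in>R u. linked L\<^sub>2 C x z \<and> linked L\<^sub>2 C z x" if "z \<in> verts L\<^sub>2" for z
    using near[OF that] two.linked_sym[OF L\<^sub>2(1)] unfolding Field_T by blast
  have image: "linked L\<^sub>2 (C * n + C) x y"
    if "linked L\<^sub>1 n u v" "x \<in> R u" "y \<in> R v" for n u v x y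
    using linked_image_of_walk[OF sub1(2) sub2(2) RL(3) C[unfolded T_def] that] .

  have "verts L\<^sub>2 \<noteq> {}"
    using one.connected_iff_linked[OF L\<^sub>1(1)] L\<^sub>1(2) RL(3) L\<^sub>2(4) Field_T by blast
  moreover have "\<exists>n. linked L\<^sub>2 n z z'" if z: "z \<in> verts L\<^sub>2" "z' \<in> verts L\<^sub>2" for z z'
  proof -
    obtain u x where u: "u \<in> verts L\<^sub>1" "x \<in> R u" "linked L\<^sub>2 C z x"
      using anchor[OF z(1)] by blast
    obtain v y where v: "v \<in> verts L\<^sub>1" "y \<in> R v" "linked L\<^sub>2 C y z'"
      using anchor[OF z(2)] by blast
    obtain n where "linked L\<^sub>1 n u v"
      using one.connected_iff_linked[OF L\<^sub>1(1)] L\<^sub>1(2) u(1) v(1) by blast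
    then show ?thesis
      using image u v linked_trans[OF sub2(2)] by meson
  qed
  ultimately have conn2: "Digraph_Component.connected L\<^sub>2"
    using two.connected_iff_linked[OF L\<^sub>2(1)] by blast

  \<comment> \<open>The constants record a round trip. Passing from \<open>z\<close>,
    \<open>z'\<close> to their anchors \<open>x\<close>, \<open>y\<close> gives length
    \<open>C + n + C\<close> in \<open>K\<^sub>2\<close>. Applying \<open>Q\<close> turns a length
    \<open>m\<close> into \<open>B * m + B\<close>, returning to \<open>u\<close>, \<open>v\<close>
    adds \<open>d\<close> twice, undistortion of \<open>L\<^sub>1\<close> turns \<open>m\<close>
    into \<open>k * m + c\<close>, and \<open>R\<close> turns \<open>m\<close> into
    \<open>C * m + C\<close>. Rejoining \<open>z\<close>, \<open>z'\<close> inside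
    \<open>L\<^sub>2\<close> adds \<open>C\<close> twice more, whence \<open>3 * C\<close>.\<close>
  have "linked L\<^sub>2 ((C * k * B) * n + (C * (k * (B * (2 * C) + B + 2 * d) + c) + 3 * C)) z z'"
    if z: "z \<in> verts L\<^sub>2" "z' \<in> verts L\<^sub>2" and n: "linked K\<^sub>2 n z z'" for z z' n
  proof -
    obtain u x where u: "u \<in> verts L\<^sub>1" "x \<in> R u" "linked L\<^sub>2 C x z" "linked L\<^sub>2 C z x"
      using anchor[OF z(1)] by blast
    obtain v y where v: "v \<in> verts L\<^sub>1" "y \<in> R v" "linked L\<^sub>2 C y z'" "linked L\<^sub>2 C z' y"
      using anchor[OF z(2)] by blast
    have uv: "u \<in> verts K\<^sub>1" "v \<in> verts K\<^sub>1" "x \<in> verts K\<^sub>2" "y \<in> verts K\<^sub>2"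
      using u v sub1(3) RL(1) by blast+
    then obtain u' v' where u'v': "u' \<in> Q x" "v' \<in> Q y"
      using Q by blast
    note trans1 = linked_trans[OF one.wf_digraph_axioms]
      and trans2 = linked_trans[OF two.wf_digraph_axioms]
      and transL = linked_trans[OF sub2(2)]
    have "linked K\<^sub>2 (C + n + C) x y"
      using trans2[OF trans2[OF _ n]] u(3) v(4) linked_subgraph[OF sub2(1)]
        two.linked_sym[OF two.subcomplex_self] by blast
    then have "linked K\<^sub>1 (B * (C + n + C) + B) u' v'"
      using linked_image_of_walk[OF two.wf_digraph_axioms one.wf_digraph_axioms _ B _ u'v'] Q
      by blast
    then have "linked K\<^sub>1 (d + (B * (C + n + C) + B) + d) u v"
      using trans1[OF trans1] d uv u v u'v' by blast
    then have "linked L\<^sub>2 (C * (k * (d + (B * (C + n + C) + B) + d) + c) + C) x y"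
      using image kc u v by blast
    then have "linked L\<^sub>2 (C + (C * (k * (d + (B * (C + n + C) + B) + d) + c) + C) + C) z z'"
      using transL[OF transL] u v by blast
    then show ?thesis
      by (rule linked_mono) (simp add: algebra_simps)
  qed
  then have "qi_embedded L\<^sub>2 K\<^sub>2 arev\<^sub>2"
    unfolding two.qi_embedded_iff_undistorted[OF L\<^sub>2(1) conn2] undistorted_def by blast
  moreover have "finite (orbits (G\<lparr>carrier := H\<rparr>) (arcs L\<^sub>2) \<psi>\<^sub>2)"
    using two.arc_action.finite_orbits_iff_orbit_finite[OF H sub2(4)] L\<^sub>2(3) by blast
  ultimately have "quasiconvexity_witness G H K\<^sub>2 arev\<^sub>2 \<phi>\<^sub>2 \<psi>\<^sub>2 L\<^sub>2"
    unfolding quasiconvexity_witness_def using L\<^sub>2(1,2) conn2 \<open>verts L\<^sub>2 \<noteq> {}\<close> by blast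
  then show ?thesis
    by blast
qed

end
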